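(* Let $\mathbb{K}$ be a totally ordered field and let $\kappa$ be an uncountable cardinal. If $\mathbb{K}$ is algebraically $\kappa$-saturated, then $\mathbb{K}$ is Cantor $\kappa$-complete; and if $\mathbb{K}$ is Cantor $\kappa$-complete, then $\mathbb{K}$ is sequentially complete.
   Context: Let $\mathbb{K}$ be a totally ordered field with the order topology and $|x|=\max(-x,x)$. - Algebraically $\kappa$-saturated ($\kappa$ an infinite cardinal): every family of fewer than $\kappa$ open intervals $(a_\gamma,b_\gamma)$ in $\mathbb{K}$ with the finite intersection property has non-empty intersection; unbounded open intervals such as $(a,\infty)$ are also allowed. - Cantor $\kappa$-complete ($\kappa$ an uncountable cardinal): every family of fewer than $\kappa$ closed bounded intervals $[a_\gamma,b_\gamma]$ in $\mathbb{K}$ with the finite intersection property has non-empty intersection. - Sequentially complete: every fundamental (Cauchy) sequence in $\mathbb{K}$ converges in $\mathbb{K}$, where $(x_n)$ is Cauchy if for every $\varepsilon>0$ in $\mathbb{K}$ there is $N\in\mathbb{N}$ with $|x_n-x_m|<\varepsilon$ for all $n,m\ge N$. *)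

theory Defs
  imports Complex_Main
begin

text \<open>
  The ordered field is a type of class \<^class>\<open>linordered_field\<close>; adding
  \<^class>\<open>linorder_topology\<close> makes its topology the order topology.
  A cardinal \<open>\<kappa>\<close> is a relation satisfying \<^const>\<open>Card_order\<close>, over an arbitrary type.
  A family of intervals is the set of its members: passing from an indexed family to its
  range does not increase the cardinality and changes neither finite nor total intersections.
\<close>

unbundle cardinal_syntax

definition finite_intersection_property :: "'a set set \<Rightarrow> bool" where
  "finite_intersection_property F \<longleftrightarrow> (\<forall>G. G \<subseteq> F \<and> finite G \<longrightarrow> \<Inter>G \<noteq> {})"

definition open_interval :: "'a::linorder set \<Rightarrow> bool" where
  "open_interval S \<longleftrightarrow>
     (\<exists>a b. S = {a<..<b}) \<or> (\<exists>a. S = {a<..}) \<or> (\<exists>b. S = {..<b}) \<or> S = UNIV"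

definition closed_bounded_interval :: "'a::linorder set \<Rightarrow> bool" where
  "closed_bounded_interval S \<longleftrightarrow> (\<exists>a b. S = {a..b})"

definition algebraically_saturated :: "'k rel \<Rightarrow> 'a::linordered_field itself \<Rightarrow> bool" where
  "algebraically_saturated \<kappa> (_ :: 'a itself) \<longleftrightarrow>
     (\<forall>F :: 'a set set. (\<forall>S\<in>F. open_interval S) \<and> |F| <o \<kappa> \<and> finite_intersection_property F
        \<longrightarrow> \<Inter>F \<noteq> {})"

definition cantor_complete :: "'k rel \<Rightarrow> 'a::linordered_field itself \<Rightarrow> bool" where
  "cantor_complete \<kappa> (_ :: 'a itself) \<longleftrightarrow>
     (\<forall>F :: 'a set set. (\<forall>S\<in>F. closed_bounded_interval S) \<and> |F| <o \<kappa> \<and> finite_intersection_property F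
        \<longrightarrow> \<Inter>F \<noteq> {})"

text \<open>
  \<^const>\<open>Cauchy\<close> needs a real-valued metric, whereas here \<open>\<epsilon>\<close> ranges over the field itself.
\<close>

definition fundamental :: "(nat \<Rightarrow> 'a::linordered_field) \<Rightarrow> bool" where
  "fundamental x \<longleftrightarrow> (\<forall>\<epsilon>>0. \<exists>N. \<forall>n\<ge>N. \<forall>m\<ge>N. \<bar>x n - x m\<bar> < \<epsilon>)"

definition sequentially_complete :: "'a::{linordered_field, linorder_topology} itself \<Rightarrow> bool" where
  "sequentially_complete (_ :: 'a itself) \<longleftrightarrow>
     (\<forall>x :: nat \<Rightarrow> 'a. fundamental x \<longrightarrow> convergent x)"

end

theory Submission
  imports Defs "HOL-Library.Countable_Set"
begin

text \<open>
  Saturation implies Cantor completeness because closed intervals fail to behave like open ones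
  only at their endpoints. Let \<open>[a, b]\<close> range over a family of closed intervals with the finite
  intersection property, so that every left endpoint lies below every right endpoint. If there is a
  greatest left endpoint, it belongs to all of the intervals. Otherwise every left endpoint is
  strictly below another one, hence strictly below all right endpoints, and by density of the
  order the open intervals \<open>(a, b)\<close> still have the finite intersection property; saturation
  supplies a common point of those.

  For sequential completeness, a Cauchy sequence \<open>x\<close> should be trapped in countably many closed
  intervals that become arbitrarily short. In a field of uncountable cofinality no sequence
  of positive radii tends to \<open>0\<close>, so the radii are taken from the sequence itself: they are
  the distances \<open>\<bar>x i - x j\<bar>\<close> that do not vanish. If these have no positive lower bound,
  they are the short radii required. If they have a lower bound \<open>\<epsilon> > 0\<close>, the Cauchy condition
  for \<open>\<epsilon>\<close> forces the sequence to be eventually constant.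
\<close>

text \<open>
  Pairwise intersections already give all the information carried by the finite intersection
  property of a family of intervals, in the form of inequalities between endpoints.
\<close>
lemma finite_intersection_property_closed_endpoints_le:
  fixes l r :: "'a::linorder set \<Rightarrow> 'a"
  assumes "finite_intersection_property F"
    and "\<And>S. S \<in> F \<Longrightarrow> S = {l S..r S}"
    and "S \<in> F" and "T \<in> F"
  shows "l S \<le> r T"
proof -
  have "\<Inter>{S, T} \<noteq> {}"
    using assms(1,3,4) unfolding finite_intersection_property_def
    by (metis bot_least finite.emptyI finite_insert insert_subset)
  then obtain z where "z \<in> S" "z \<in> T"
    by auto
  then have "l S \<le> z" "z \<le> r T"
    using assms(2)[OF assms(3)] assms(2)[OF assms(4)] by (metis atLeastAtMost_iff)+
  then show ?thesis
    by (rule order_trans)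
qed

lemma finite_intersection_property_open_intervals:
  fixes l r :: "'i \<Rightarrow> 'a::unbounded_dense_linorder"
  assumes less: "\<And>i j. i \<in> I \<Longrightarrow> j \<in> I \<Longrightarrow> l i < r j"
  shows "finite_intersection_property ((\<lambda>i. {l i<..<r i}) ` I)"
  unfolding finite_intersection_property_def
proof (intro allI impI, elim conjE)
  fix G
  assume "G \<subseteq> (\<lambda>i. {l i<..<r i}) ` I" and "finite G"
  then obtain J where J: "J \<subseteq> I" "finite J" and G: "G = (\<lambda>i. {l i<..<r i}) ` J"
    using finite_subset_image[of G] by meson
  show "\<Inter>G \<noteq> {}"
  proof (cases "J = {}")
    case True
    then show ?thesis
      using G by simp
  next
    case False
    have "Max (l ` J) \<in> l ` J" "Min (r ` J) \<in> r ` J"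
      using J(2) False by simp_all
    then obtain i j where "i \<in> J" "j \<in> J" "Max (l ` J) = l i" "Min (r ` J) = r j"
      by (elim imageE)
    then have "Max (l ` J) < Min (r ` J)"
      using less J(1) by (simp add: subset_iff)
    from dense[OF this] obtain z where "Max (l ` J) < z" "z < Min (r ` J)"
      by (elim exE conjE)
    then have "z \<in> \<Inter>G"
      using J(2) False by (auto simp: G)
    then show ?thesis
      by blast
  qed
qed

lemma cantor_complete_if_algebraically_saturated:
  fixes \<kappa> :: "'k rel"
  assumes "algebraically_saturated \<kappa> TYPE('a::linordered_field)"
  shows "cantor_complete \<kappa> TYPE('a)"
  unfolding cantor_complete_def
proof (intro allI impI, elim conjE)
  fix F :: "'a set set"
  assume closed: "\<forall>S\<in>F. closed_bounded_interval S" and card: "|F| <o \<kappa>"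
    and fip: "finite_intersection_property F"
  obtain l r where lr: "\<And>S. S \<in> F \<Longrightarrow> S = {l S..r S}"
    using closed unfolding closed_bounded_interval_def by metis
  have le: "l S \<le> r T" if "S \<in> F" "T \<in> F" for S T
    using finite_intersection_property_closed_endpoints_le[OF fip lr that] .
  show "\<Inter>F \<noteq> {}"
  proof (cases "\<exists>S\<in>F. \<forall>T\<in>F. l T \<le> l S")
    case True
    then obtain S where "S \<in> F" "\<forall>T\<in>F. l T \<le> l S"
      by blast
    then have "l S \<in> {l T..r T}" if "T \<in> F" for T
      using le that by simp
    then have "l S \<in> \<Inter>F"
      using lr by blast
    then show ?thesis
      by blast
  next
    case False
    have less: "l S < r T" if "S \<in> F" "T \<in> F" for S T
      using False le that by (meson less_le_trans not_le)
    define G where "G = (\<lambda>S. {l S<..<r S}) ` F"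
    have "\<forall>S\<in>G. open_interval S"
      unfolding G_def open_interval_def by blast
    moreover have "|G| <o \<kappa>"
      unfolding G_def using card_of_image card by (rule ordLeq_ordLess_trans)
    moreover have "finite_intersection_property G"
      unfolding G_def using less by (rule finite_intersection_property_open_intervals)
    ultimately have "\<Inter>G \<noteq> {}"
      using assms unfolding algebraically_saturated_def by blast
    then obtain z where z: "z \<in> \<Inter>G"
      by blast
    have "z \<in> {l S..r S}" if "S \<in> F" for S
      using z that unfolding G_def by force
    then have "z \<in> \<Inter>F"
      using lr by blast
    then show ?thesis
      by blast
  qed
qed

lemma countable_card_of_ordLess:
  assumes "natLeq <o \<kappa>" and "countable F"
  shows "|F| <o \<kappa>"
proof -
  have "|F| \<le>o |UNIV :: nat set|"
    using assms(2) card_of_ordLeq unfolding countable_def by blast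
  then show ?thesis
    using card_of_nat assms(1) by (meson ordLeq_ordIso_trans ordLeq_ordLess_trans)
qed

text \<open>
  The tails of a sequence form a filter base, so any sets that each contain a tail have the
  finite intersection property.
\<close>
lemma finite_intersection_property_eventually:
  assumes "\<And>S. S \<in> F \<Longrightarrow> eventually (\<lambda>n. x n \<in> S) sequentially"
  shows "finite_intersection_property F"
  unfolding finite_intersection_property_def
proof (intro allI impI, elim conjE)
  fix G
  assume "G \<subseteq> F" "finite G"
  then have "eventually (\<lambda>n. \<forall>S\<in>G. x n \<in> S) sequentially"
    using assms by (intro eventually_ball_finite ballI) (auto dest: subsetD)
  then obtain n where "\<forall>S\<in>G. x n \<in> S"
    using eventually_happens'[OF sequentially_bot] by blast
  then show "\<Inter>G \<noteq> {}"
    by blast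
qed

text \<open>
  The topology of an ordered field is an order topology rather than a metric one, so the
  \<open>\<epsilon>\<close>-criterion has to be derived from order neighbourhoods.
\<close>
lemma tendsto_if_abs_diff_less:
  fixes x :: "'b \<Rightarrow> 'a::{linordered_field, linorder_topology}"
  assumes "\<And>\<epsilon>. \<epsilon> > 0 \<Longrightarrow> eventually (\<lambda>n. \<bar>x n - L\<bar> < \<epsilon>) A"
  shows "(x \<longlongrightarrow> L) A"
proof (rule order_tendstoI)
  fix a assume "a < L"
  then show "eventually (\<lambda>n. a < x n) A"
    using assms[of "L - a"] by (auto elim!: eventually_mono simp: abs_less_iff)
next
  fix a assume "L < a"
  then show "eventually (\<lambda>n. x n < a) A"
    using assms[of "a - L"] by (auto elim!: eventually_mono simp: abs_less_iff)
qed

text \<open>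
  If the nonzero distances are bounded below, then the terms of a tail are pairwise equal.
\<close>
lemma convergent_if_distances_bounded_below:
  fixes x :: "nat \<Rightarrow> 'a::{linordered_field, linorder_topology}"
  assumes "fundamental x" and "\<epsilon> > 0"
    and bound: "\<And>i j. x i \<noteq> x j \<Longrightarrow> \<epsilon> \<le> \<bar>x i - x j\<bar>"
  shows "convergent x"
proof -
  obtain N where "\<forall>n\<ge>N. \<forall>m\<ge>N. \<bar>x n - x m\<bar> < \<epsilon>"
    using assms(1,2) unfolding fundamental_def by blast
  then have "\<forall>n\<ge>N. x n = x N"
    using bound by (meson le_refl not_le)
  then have "eventually (\<lambda>n. x n = x N) sequentially"
    unfolding eventually_sequentially by blast
  then have "x \<longlonglongrightarrow> x N"
    by (rule tendsto_eventually)
  then show ?thesis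
    by (rule convergentI)
qed

text \<open>
  The trapping intervals are those centred at a term of the sequence, with a distance between two
  terms as radius, that contain a tail. There are countably many, being indexed by triples
  of natural numbers, and the Cauchy condition provides one for every nonzero distance.
\<close>
lemma convergent_if_distances_arbitrarily_small:
  fixes x :: "nat \<Rightarrow> 'a::{linordered_field, linorder_topology}" and \<kappa> :: "'k rel"
  assumes "natLeq <o \<kappa>" and complete: "cantor_complete \<kappa> TYPE('a)" and cauchy: "fundamental x"
    and small: "\<And>\<epsilon>. \<epsilon> > 0 \<Longrightarrow> \<exists>i j. x i \<noteq> x j \<and> \<bar>x i - x j\<bar> < \<epsilon>"
  shows "convergent x"
proof -
  define I where "I = (\<lambda>(p, i, j). {x p - \<bar>x i - x j\<bar>..x p + \<bar>x i - x j\<bar>})"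
  define F where "F = {S \<in> range I. eventually (\<lambda>n. x n \<in> S) sequentially}"
  have "countable F"
    unfolding F_def by (rule countable_subset[of _ "range I"]) auto
  then have "|F| <o \<kappa>"
    using assms(1) by (rule countable_card_of_ordLess[rotated])
  moreover have "\<forall>S\<in>F. closed_bounded_interval S"
    unfolding F_def I_def closed_bounded_interval_def by auto
  moreover have "finite_intersection_property F"
    by (rule finite_intersection_property_eventually[of _ x]) (simp add: F_def)
  ultimately have "\<Inter>F \<noteq> {}"
    using complete unfolding cantor_complete_def by blast
  then obtain L where L: "L \<in> \<Inter>F"
    by blast
  have "x \<longlonglongrightarrow> L"
  proof (rule tendsto_if_abs_diff_less)
    fix \<epsilon> :: 'a assume "\<epsilon> > 0"
    \<comment> \<open>The limit and a tail will lie in one trapping interval, so their distance is at most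
      twice its radius.\<close>
    then obtain i j where ij: "x i \<noteq> x j" "\<bar>x i - x j\<bar> < \<epsilon> / 2"
      using small[of "\<epsilon> / 2"] by auto
    define d where "d = \<bar>x i - x j\<bar>"
    have "d > 0"
      using ij(1) by (simp add: d_def)
    then obtain p where p: "\<forall>n\<ge>p. \<forall>m\<ge>p. \<bar>x n - x m\<bar> < d"
      using cauchy unfolding fundamental_def by blast
    have tail: "x n \<in> I (p, i, j)" if "n \<ge> p" for n
    proof -
      have "\<bar>x n - x p\<bar> < d"
        using p that by blast
      then show ?thesis
        by (auto simp: I_def abs_less_iff simp flip: d_def)
    qed
    then have "I (p, i, j) \<in> F"
      unfolding F_def eventually_sequentially by blast
    then have "L \<in> I (p, i, j)"
      using L by blast
    then have "\<bar>x n - L\<bar> < \<epsilon>" if "n \<ge> p" for n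
      using tail[OF that] ij(2) by (auto simp: I_def abs_less_iff simp flip: d_def)
    then show "eventually (\<lambda>n. \<bar>x n - L\<bar> < \<epsilon>) sequentially"
      unfolding eventually_sequentially by blast
  qed
  then show ?thesis
    by (rule convergentI)
qed

lemma sequentially_complete_if_cantor_complete:
  fixes \<kappa> :: "'k rel"
  assumes "natLeq <o \<kappa>"
    and "cantor_complete \<kappa> TYPE('a::{linordered_field, linorder_topology})"
  shows "sequentially_complete TYPE('a)"
  unfolding sequentially_complete_def
proof (intro allI impI)
  fix x :: "nat \<Rightarrow> 'a"
  assume cauchy: "fundamental x"
  show "convergent x"
  proof (cases "\<exists>\<epsilon>>0. \<forall>i j. x i \<noteq> x j \<longrightarrow> \<epsilon> \<le> \<bar>x i - x j\<bar>")
    case True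
    then show ?thesis
      using convergent_if_distances_bounded_below[OF cauchy] by blast
  next
    case False
    then have "\<exists>i j. x i \<noteq> x j \<and> \<bar>x i - x j\<bar> < \<epsilon>" if "\<epsilon> > 0" for \<epsilon>
      using that by (meson not_le)
    then show ?thesis
      by (rule convergent_if_distances_arbitrarily_small[OF assms cauchy])
  qed
qed

theorem theorem5p6:
  fixes \<kappa> :: "'k rel"
  assumes "Card_order \<kappa>" and "natLeq <o \<kappa>"
  shows "(algebraically_saturated \<kappa> TYPE('a::{linordered_field, linorder_topology})
            \<longrightarrow> cantor_complete \<kappa> TYPE('a))
       \<and> (cantor_complete \<kappa> TYPE('a) \<longrightarrow> sequentially_complete TYPE('a))"
  using cantor_complete_if_algebraically_saturated
    sequentially_complete_if_cantor_complete[OF assms(2)]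
  by blast

end
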